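(* Let $X$ be a time-homogeneous Markov process on a Polish space $\mathbb{X}$, $f:\mathbb{X}\to[0,\infty)$ a bounded Borel payoff function, and $\delta:\{0,1,2,\dots\}\to[0,1]$ a strictly decreasing discount function with $\delta(0)=1$ and $\lim_{k\to\infty}\delta(k)=0$. Suppose that $\delta(i)\delta(j)\le\delta(i+j)$ for all $i,j=0,1,2,\dots$. Then for any nonempty $S\in\mathcal{B}(\mathbb{X})$ such that $\Theta(S)\subseteq S$, the set $$S_\infty:=\bigcap_{n=1}^\infty\Theta^n(S)$$ is nonempty and is an equilibrium, i.e. $\Theta(S_\infty)=S_\infty$.
   Context: Setting. $\mathbb{X}$ is a Polish space with Borel $\sigma$-algebra $\mathcal{B}(\mathbb{X})$; $X=(X_t)_{t=0,1,2,\dots}$ is a time-homogeneous $\mathbb{X}$-valued Markov process with transition kernel $Q$, i.e. $\mathbb{P}(X_{t+1}\in A\mid X_t=x)=\int_A Q(x,dy)$ for all $t\ge 0$, $x\in\mathbb{X}$, $A\in\mathcal{B}(\mathbb{X})$. Write $X^x$ for the process started at $X_0=x$ and $\mathbb{E}^x$ for expectation conditional on $X_0=x$. Stopping times are with respect to the filtration generated by $X$ and may take the value $\infty$. For $x\in\mathbb{X}$ and a stopping time $\tau$, $J(x,\tau):=\mathbb{E}^x[\delta(\tau)f(X_\tau)]$, where $\delta(\tau)f(X_\tau):=0$ on $\{\tau=\infty\}$. For $S\in\mathcal{B}(\mathbb{X})$, $\rho(x,S):=\inf\{t\ge 1: X^x_t\in S\}$ (with $\inf\emptyset=\infty$), and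 $$\Theta(S):=\{x\in\mathbb{X}: f(x)\ge J(x,\rho(x,S))\}\in\mathcal{B}(\mathbb{X}).$$ $\Theta^n$ is the $n$-fold composition of $\Theta$. A set $S\in\mathcal{B}(\mathbb{X})$ is called an equilibrium if $\Theta(S)=S$. *)

theory Defs
  imports "HOL-Probability.Probability"
begin

definition natural_filtration :: "'w measure \<Rightarrow> (nat \<Rightarrow> 'w \<Rightarrow> 'a::topological_space) \<Rightarrow> nat \<Rightarrow> 'w measure" where
  "natural_filtration \<Omega> X t =
     sigma (space \<Omega>) (\<Union>s\<in>{..t}. {X s -` A \<inter> space \<Omega> |A. A \<in> sets borel})"

text \<open>
  A time-homogeneous Markov process with transition kernel \<open>Q\<close>, given as a family of laws
  \<open>P x\<close> on one measurable space: \<open>P x\<close> makes the process \<open>X\<close> start at \<open>x\<close>. The measure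
  carried by \<open>\<Omega>\<close> is irrelevant; only its sample space and sigma-algebra are used. The membership
  of \<open>Q\<close> in \<open>borel \<rightarrow>\<^sub>M prob_algebra borel\<close> says that \<open>Q\<close> is a Borel probability kernel.
\<close>

locale markov_process =
  fixes \<Omega> :: "'w measure"
    and Q :: "'a::polish_space \<Rightarrow> 'a measure"
    and P :: "'a \<Rightarrow> 'w measure"
    and X :: "nat \<Rightarrow> 'w \<Rightarrow> 'a"
  assumes kernel: "Q \<in> borel \<rightarrow>\<^sub>M prob_algebra borel"
    and prob_space_P: "\<And>x. prob_space (P x)"
    and sets_P: "\<And>x. sets (P x) = sets \<Omega>"
    and measurable_X: "\<And>t. X t \<in> \<Omega> \<rightarrow>\<^sub>M borel"
    and start: "\<And>x. AE \<omega> in P x. X 0 \<omega> = x"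
    and markov: "\<And>x t A. A \<in> sets borel \<Longrightarrow>
      AE \<omega> in P x.
        real_cond_exp (P x) (natural_filtration \<Omega> X t) (\<lambda>\<omega>'. indicator A (X (Suc t) \<omega>')) \<omega>
          = measure (Q (X t \<omega>)) A"

text \<open>The discounted payoff \<open>J(x, \<tau>)\<close>; it is zero on the event that \<open>\<tau>\<close> is infinite.\<close>

definition payoff ::
  "('a \<Rightarrow> 'w measure) \<Rightarrow> (nat \<Rightarrow> 'w \<Rightarrow> 'a) \<Rightarrow> (nat \<Rightarrow> real) \<Rightarrow> ('a \<Rightarrow> real) \<Rightarrow> 'a \<Rightarrow> ('w \<Rightarrow> enat) \<Rightarrow> real" where
  "payoff P X \<delta> f x \<tau> =
     (\<integral>\<omega>. (case \<tau> \<omega> of enat t \<Rightarrow> \<delta> t * f (X t \<omega>) | \<infinity> \<Rightarrow> 0) \<partial>P x)"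

text \<open>
  The first time \<open>t \<ge> 1\<close> at which \<open>X\<close> is in \<open>S\<close>, with \<open>Inf {} = \<infinity>\<close> on type \<^typ>\<open>enat\<close>. The starting
  point enters only through the law \<open>P x\<close>.
\<close>

definition return_time :: "(nat \<Rightarrow> 'w \<Rightarrow> 'a) \<Rightarrow> 'a set \<Rightarrow> 'w \<Rightarrow> enat" where
  "return_time X S \<omega> = Inf {enat t |t. 1 \<le> t \<and> X t \<omega> \<in> S}"

lemma return_time_le_iff: "return_time X S \<omega> \<le> enat n \<longleftrightarrow> (\<exists>t\<in>{1..n}. X t \<omega> \<in> S)"
proof
  assume le: "return_time X S \<omega> \<le> enat n"
  let ?A = "{enat t |t. 1 \<le> t \<and> X t \<omega> \<in> S}"
  have "?A \<noteq> {}"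
  proof
    assume "?A = {}"
    then have "return_time X S \<omega> = \<infinity>"
      unfolding return_time_def Inf_enat_def by (simp only: simp_thms if_True)
    with le show False by simp
  qed
  then have "Inf ?A \<in> ?A"
    unfolding Inf_enat_def by (metis (mono_tags, lifting) LeastI ex_in_conv)
  then show "\<exists>t\<in>{1..n}. X t \<omega> \<in> S"
    using le unfolding return_time_def by auto
next
  assume "\<exists>t\<in>{1..n}. X t \<omega> \<in> S"
  then obtain t where t: "1 \<le> t" "t \<le> n" "X t \<omega> \<in> S" by auto
  have "return_time X S \<omega> \<le> enat t"
    unfolding return_time_def by (rule Inf_lower) (use t in auto)
  also have "\<dots> \<le> enat n" using t by simp
  finally show "return_time X S \<omega> \<le> enat n" .
qed

text \<open>The return time to a Borel set is a stopping time with respect to the natural filtration.\<close>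

lemma return_time_stopping:
  assumes "S \<in> sets borel"
  shows "{\<omega> \<in> space \<Omega>. return_time X S \<omega> \<le> enat n} \<in> sets (natural_filtration \<Omega> X n)"
proof -
  have "X t -` S \<inter> space \<Omega> \<in> sets (natural_filtration \<Omega> X n)" if "t \<in> {1..n}" for t
    unfolding natural_filtration_def
    by (rule in_measure_of) (use that assms in auto)
  then have "(\<Union>t\<in>{1..n}. X t -` S \<inter> space \<Omega>) \<in> sets (natural_filtration \<Omega> X n)"
    by (intro sets.finite_UN) auto
  also have "(\<Union>t\<in>{1..n}. X t -` S \<inter> space \<Omega>) = {\<omega> \<in> space \<Omega>. return_time X S \<omega> \<le> enat n}"
    by (auto simp: return_time_le_iff)
  finally show ?thesis .
qed

definition Theta ::
  "('a \<Rightarrow> 'w measure) \<Rightarrow> (nat \<Rightarrow> 'w \<Rightarrow> 'a) \<Rightarrow> (nat \<Rightarrow> real) \<Rightarrow> ('a \<Rightarrow> real) \<Rightarrow> 'a set \<Rightarrow> 'a set" where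
  "Theta P X \<delta> f S = {x. f x \<ge> payoff P X \<delta> f x (return_time X S)}"

definition equilibrium ::
  "('a::topological_space \<Rightarrow> 'w measure) \<Rightarrow> (nat \<Rightarrow> 'w \<Rightarrow> 'a) \<Rightarrow> (nat \<Rightarrow> real) \<Rightarrow> ('a \<Rightarrow> real) \<Rightarrow> 'a set \<Rightarrow> bool" where
  "equilibrium P X \<delta> f S \<longleftrightarrow> S \<in> sets borel \<and> Theta P X \<delta> f S = S"

end

theory Submission
  imports Defs
begin

text \<open>
  Suppose \<open>\<Theta>(S) \<subseteq> S\<close>. On \<open>S - \<Theta>(S)\<close> the payoff \<open>f\<close> is below the value of waiting for the next
  visit to \<open>S\<close>, and since \<open>\<delta>(i) \<delta>(j) \<le> \<delta>(i + j)\<close> this stays true when both are discounted from an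
  earlier date. Skipping the visits to \<open>S - \<Theta>(S)\<close> one after another therefore gives
  \<open>J(x, \<rho>(x, S)) \<le> J(x, \<rho>(x, \<Theta>(S)))\<close>. So the sets \<open>\<Theta>\<^sup>n(S)\<close> decrease while their values increase,
  and by dominated convergence the values tend to that of \<open>S\<^sub>\<infinity>\<close>; hence \<open>f \<ge> J(\<cdot>, \<rho>(\<cdot>, S\<^sub>\<infinity>))\<close> exactly on
  \<open>S\<^sub>\<infinity>\<close>. It is nonempty because \<open>\<Theta>({})\<close> is the whole space.
\<close>

section \<open>Values of first hits, computed from the kernel alone\<close>

text \<open>
  \<open>first_hit_value Q S g n x\<close> is the expectation of \<open>g(X\<^sub>\<rho>)\<close> on the event \<open>\<rho> = n + 1\<close>, where \<open>\<rho>\<close> is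
  the return time to \<open>S\<close>; \<open>shifted_value Q S g d m x\<close> is the expectation of \<open>d(m + \<rho>) g(X\<^sub>\<rho>)\<close>. Going
  through the kernel makes measurability in \<open>x\<close> provable, as \<open>P\<close> is not assumed measurable.
\<close>

fun first_hit_value ::
  "('a \<Rightarrow> 'a measure) \<Rightarrow> 'a set \<Rightarrow> ('a \<Rightarrow> ennreal) \<Rightarrow> nat \<Rightarrow> 'a \<Rightarrow> ennreal" where
  "first_hit_value Q S g 0 x = (\<integral>\<^sup>+y. indicator S y * g y \<partial>Q x)"
| "first_hit_value Q S g (Suc n) x =
     (\<integral>\<^sup>+y. indicator (- S) y * first_hit_value Q S g n y \<partial>Q x)"

definition shifted_value ::
  "('a \<Rightarrow> 'a measure) \<Rightarrow> 'a set \<Rightarrow> ('a \<Rightarrow> ennreal) \<Rightarrow> (nat \<Rightarrow> ennreal) \<Rightarrow> nat \<Rightarrow> 'a \<Rightarrow> ennreal" where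
  "shifted_value Q S g d m x = (\<Sum>t. d (Suc (m + t)) * first_hit_value Q S g t x)"

lemma kernel_sets_prob_space:
  fixes Q :: "'a::topological_space \<Rightarrow> 'a measure"
  assumes "Q \<in> borel \<rightarrow>\<^sub>M prob_algebra borel"
  shows "sets (Q x) = sets borel" and "prob_space (Q x)"
  using measurable_space[OF assms, of x] by (simp_all add: space_prob_algebra)

lemma first_hit_value_measurable [measurable]:
  fixes Q :: "'a::topological_space \<Rightarrow> 'a measure"
  assumes Q [measurable]: "Q \<in> borel \<rightarrow>\<^sub>M prob_algebra borel"
    and S [measurable]: "S \<in> sets borel" and g [measurable]: "g \<in> borel_measurable borel"
  shows "first_hit_value Q S g n \<in> borel_measurable borel"
proof -
  have [measurable]: "Q \<in> borel \<rightarrow>\<^sub>M subprob_algebra borel"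
    using Q by (rule measurable_prob_algebraD)
  show ?thesis
  proof (induction n)
    case (Suc n)
    note [measurable] = Suc
    show ?case
      unfolding first_hit_value.simps by measurable
  qed (unfold first_hit_value.simps, measurable)
qed

lemma shifted_value_measurable:
  fixes Q :: "'a::topological_space \<Rightarrow> 'a measure"
  assumes [measurable]: "Q \<in> borel \<rightarrow>\<^sub>M prob_algebra borel"
    and [measurable]: "S \<in> sets borel" and [measurable]: "g \<in> borel_measurable borel"
  shows "shifted_value Q S g d m \<in> borel_measurable borel"
  unfolding shifted_value_def by measurable

text \<open>Conditioning on the first step: the term \<open>t = 0\<close> of the series pays on
  \<open>S\<close>, and the remaining terms form the same series restarted from \<open>y\<close>
  with the clock advanced by one.\<close>

lemma shifted_value_eq:
  fixes Q :: "'a::topological_space \<Rightarrow> 'a measure"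
  assumes Q: "Q \<in> borel \<rightarrow>\<^sub>M prob_algebra borel"
    and S: "S \<in> sets borel" and g: "g \<in> borel_measurable borel"
  shows "shifted_value Q S g d m x =
    (\<integral>\<^sup>+y. (if y \<in> S then d (Suc m) * g y else shifted_value Q S g d (Suc m) y) \<partial>Q x)"
proof -
  note [measurable] = Q S g
  note [measurable_cong] = kernel_sets_prob_space(1)[OF Q]
  note [measurable] = shifted_value_measurable[OF Q S g]
  have "shifted_value Q S g d m x =
      (\<Sum>t. d (Suc (m + Suc t)) * first_hit_value Q S g (Suc t) x)
        + d (Suc m) * first_hit_value Q S g 0 x"
    unfolding shifted_value_def
    by (subst suminf_offset[where i=1]) (auto simp: add.commute)
  also have "(\<Sum>t. d (Suc (m + Suc t)) * first_hit_value Q S g (Suc t) x)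
      = (\<integral>\<^sup>+y. (\<Sum>t. indicator (- S) y * (d (Suc (m + Suc t)) * first_hit_value Q S g t y)) \<partial>Q x)"
    by (subst nn_integral_suminf) (auto simp: nn_integral_cmult[symmetric] ac_simps)
  also have "\<dots> = (\<integral>\<^sup>+y. indicator (- S) y * shifted_value Q S g d (Suc m) y \<partial>Q x)"
    by (simp add: shifted_value_def)
  also have "d (Suc m) * first_hit_value Q S g 0 x
      = (\<integral>\<^sup>+y. d (Suc m) * (indicator S y * g y) \<partial>Q x)"
    by (simp add: nn_integral_cmult)
  also have "(\<integral>\<^sup>+y. indicator (- S) y * shifted_value Q S g d (Suc m) y \<partial>Q x)
      + (\<integral>\<^sup>+y. d (Suc m) * (indicator S y * g y) \<partial>Q x)
      = (\<integral>\<^sup>+y. indicator (- S) y * shifted_value Q S g d (Suc m) y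
           + d (Suc m) * (indicator S y * g y) \<partial>Q x)"
    by (rule nn_integral_add[symmetric]) measurable
  also have "\<dots> = (\<integral>\<^sup>+y. (if y \<in> S then d (Suc m) * g y
      else shifted_value Q S g d (Suc m) y) \<partial>Q x)"
    by (intro nn_integral_cong) auto
  finally show ?thesis .
qed

text \<open>First hits at different times are disjoint events, so the sum is a mean of values
  bounded by \<open>C\<close>. In the induction, at each \<open>y\<close> only one of
  \<open>S\<close> and \<open>- S\<close> contributes.\<close>

lemma sum_first_hit_value_le:
  fixes Q :: "'a::topological_space \<Rightarrow> 'a measure"
  assumes Q: "Q \<in> borel \<rightarrow>\<^sub>M prob_algebra borel"
    and S: "S \<in> sets borel" and g: "g \<in> borel_measurable borel"
    and le: "\<And>y. g y \<le> C"
  shows "(\<Sum>t<n. first_hit_value Q S g t x) \<le> C"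
proof (induction n arbitrary: x)
  case (Suc n)
  note [measurable] = Q S g
  note [measurable_cong] = kernel_sets_prob_space(1)[OF Q]
  interpret prob_space "Q x" by (rule kernel_sets_prob_space(2)[OF Q])
  have "(\<Sum>t<Suc n. first_hit_value Q S g t x) =
      (\<integral>\<^sup>+y. indicator S y * g y \<partial>Q x) +
      (\<integral>\<^sup>+y. (\<Sum>t<n. indicator (- S) y * first_hit_value Q S g t y) \<partial>Q x)"
    by (simp only: sum.lessThan_Suc_shift first_hit_value.simps) (subst nn_integral_sum, measurable)
  also have "\<dots> = (\<integral>\<^sup>+y. indicator S y * g y +
      (\<Sum>t<n. indicator (- S) y * first_hit_value Q S g t y) \<partial>Q x)"
    by (rule nn_integral_add[symmetric]) measurable
  also have "\<dots> \<le> (\<integral>\<^sup>+y. C \<partial>Q x)"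
    using Suc le by (intro nn_integral_mono) (auto simp: indicator_def)
  also have "\<dots> = C" by (simp add: emeasure_space_1)
  finally show ?case .
qed simp

lemma shifted_value_le:
  fixes Q :: "'a::topological_space \<Rightarrow> 'a measure"
  assumes "Q \<in> borel \<rightarrow>\<^sub>M prob_algebra borel"
    and "S \<in> sets borel" and "g \<in> borel_measurable borel"
    and "\<And>y. g y \<le> C" and d: "antimono d"
  shows "shifted_value Q S g d m x \<le> d m * C"
  unfolding shifted_value_def
proof (rule suminf_le_const)
  fix n
  have "(\<Sum>t<n. d (Suc (m + t)) * first_hit_value Q S g t x)
      \<le> (\<Sum>t<n. d m * first_hit_value Q S g t x)"
    by (intro sum_mono mult_right_mono antimonoD[OF d]) auto
  also have "\<dots> \<le> d m * C"
    unfolding sum_distrib_left[symmetric]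
    by (intro mult_left_mono sum_first_hit_value_le assms) auto
  finally show "(\<Sum>t<n. d (Suc (m + t)) * first_hit_value Q S g t x) \<le> d m * C" .
qed auto

text \<open>Holds term by term, as \<open>d m * d (Suc t) \<le> d (m + Suc t)\<close>. It carries a
  preference for waiting from date \<open>0\<close> over to date \<open>m\<close>.\<close>

lemma mult_shifted_value_le:
  assumes "\<And>i j. d i * d j \<le> d (i + j)"
  shows "d m * shifted_value Q S g d 0 x \<le> shifted_value Q S g d m x"
proof -
  have "d m * shifted_value Q S g d 0 x = (\<Sum>t. d m * d (Suc t) * first_hit_value Q S g t x)"
    by (simp add: shifted_value_def mult.assoc)
  also have "\<dots> \<le> shifted_value Q S g d m x"
    unfolding shifted_value_def using assms[of m "Suc _"]
    by (intro suminf_le mult_right_mono) auto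
  finally show ?thesis .
qed

text \<open>
  If stopping on \<open>S - A\<close> is worse than waiting for the next visit to \<open>S\<close>, then waiting for \<open>A\<close>
  is better than waiting for \<open>S\<close>. Each step of the one-step recursion postpones the
  comparison by one period, and the error \<open>d (m + n) * C\<close> dies out because \<open>d\<close> tends to \<open>0\<close>.
\<close>

lemma shifted_value_mono:
  fixes Q :: "'a::topological_space \<Rightarrow> 'a measure"
  assumes Q: "Q \<in> borel \<rightarrow>\<^sub>M prob_algebra borel"
    and S: "S \<in> sets borel" and A: "A \<in> sets borel" and g: "g \<in> borel_measurable borel"
    and le: "\<And>y. g y \<le> C" "C < \<infinity>" and d: "antimono d" "d \<longlonglongrightarrow> 0"
    and sup: "\<And>i j. d i * d j \<le> d (i + j)"
    and "A \<subseteq> S" and wait: "\<And>y. y \<in> S - A \<Longrightarrow> g y \<le> shifted_value Q S g d 0 y"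
  shows "shifted_value Q S g d m x \<le> shifted_value Q A g d m x"
proof -
  have approx: "shifted_value Q S g d m x \<le> shifted_value Q A g d m x + d (m + n) * C" for n m x
  proof (induction n arbitrary: m x)
    case 0
    show ?case
      using shifted_value_le[OF Q S g le(1) d(1), of m x] by (simp add: add_increasing)
  next
    case (Suc n)
    note [measurable] = Q S A g shifted_value_measurable[OF Q A g]
    note [measurable_cong] = kernel_sets_prob_space(1)[OF Q]
    interpret prob_space "Q x" by (rule kernel_sets_prob_space(2)[OF Q])
    have "shifted_value Q S g d m x =
        (\<integral>\<^sup>+y. (if y \<in> S then d (Suc m) * g y else shifted_value Q S g d (Suc m) y) \<partial>Q x)"
      by (rule shifted_value_eq[OF Q S g])
    also have "\<dots> \<le> (\<integral>\<^sup>+y. (if y \<in> A then d (Suc m) * g y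
        else shifted_value Q A g d (Suc m) y) + d (m + Suc n) * C \<partial>Q x)"
    proof (rule nn_integral_mono)
      fix y
      \<comment> \<open>On \<open>S - A\<close> one side stops while the other goes on. The
        preference for waiting, moved to date \<open>Suc m\<close>, reduces this case to that of
        \<open>y\<close> outside \<open>S\<close>, where the induction hypothesis applies.\<close>
      have "d (Suc m) * g y \<le> shifted_value Q S g d (Suc m) y" if "y \<in> S - A"
      proof -
        have "d (Suc m) * g y \<le> d (Suc m) * shifted_value Q S g d 0 y"
          using wait[OF that] by (intro mult_left_mono) auto
        also have "\<dots> \<le> shifted_value Q S g d (Suc m) y"
          by (rule mult_shifted_value_le[OF sup])
        finally show ?thesis .
      qed
      then show "(if y \<in> S then d (Suc m) * g y else shifted_value Q S g d (Suc m) y)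
          \<le> (if y \<in> A then d (Suc m) * g y else shifted_value Q A g d (Suc m) y)
             + d (m + Suc n) * C"
        using Suc[of "Suc m" y] \<open>A \<subseteq> S\<close> by (auto intro: order_trans add_increasing2)
    qed
    also have "\<dots> = (\<integral>\<^sup>+y. (if y \<in> A then d (Suc m) * g y
        else shifted_value Q A g d (Suc m) y) \<partial>Q x) + d (m + Suc n) * C"
      by (subst nn_integral_add) (auto simp: emeasure_space_1)
    also have "\<dots> = shifted_value Q A g d m x + d (m + Suc n) * C"
      by (simp only: shifted_value_eq[OF Q A g, symmetric])
    finally show ?case .
  qed
  have "(\<lambda>n. d (m + n)) \<longlonglongrightarrow> 0"
    using LIMSEQ_ignore_initial_segment[OF d(2), of m] by (simp add: add.commute)
  \<comment> \<open>Finiteness of \<open>C\<close> matters here: in \<open>ennreal\<close>, a null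
    sequence times an infinite constant need not tend to \<open>0\<close>.\<close>
  from ennreal_tendsto_cmult[OF _ this, of C]
  have "(\<lambda>n. shifted_value Q A g d m x + d (m + n) * C)
      \<longlonglongrightarrow> shifted_value Q A g d m x + 0"
    using le(2) by (intro tendsto_add tendsto_const) (auto simp: mult.commute)
  then show ?thesis
    by (intro LIMSEQ_le_const) (use approx in auto)
qed

section \<open>Return times and discounted rewards along a single path\<close>

lemma return_time_eq_enat_iff:
  "return_time X S \<omega> = enat t \<longleftrightarrow> 1 \<le> t \<and> X t \<omega> \<in> S \<and> (\<forall>s\<in>{1..<t}. X s \<omega> \<notin> S)"
proof -
  have "return_time X S \<omega> = enat t \<longleftrightarrow>
      return_time X S \<omega> \<le> enat t \<and> (\<forall>s<t. \<not> return_time X S \<omega> \<le> enat s)"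
    by (cases "return_time X S \<omega>") (auto simp: not_le le_less)
  also have "\<dots> \<longleftrightarrow> 1 \<le> t \<and> X t \<omega> \<in> S \<and> (\<forall>s\<in>{1..<t}. X s \<omega> \<notin> S)"
    (is "?first \<longleftrightarrow> ?hit")
  proof
    assume first: ?first
    then obtain u where "u \<in> {1..t}" "X u \<omega> \<in> S"
      by (auto simp: return_time_le_iff)
    moreover have "\<forall>s\<in>{1..<t}. X s \<omega> \<notin> S"
      using first by (auto simp: return_time_le_iff)
    ultimately show ?hit
      by (cases "u = t") auto
  qed (auto simp: return_time_le_iff)
  finally show ?thesis .
qed

lemma return_time_eq_infinity_iff:
  "return_time X S \<omega> = \<infinity> \<longleftrightarrow> (\<forall>t\<ge>1. X t \<omega> \<notin> S)"
proof -
  have "return_time X S \<omega> = \<infinity> \<longleftrightarrow> (\<forall>n. \<not> return_time X S \<omega> \<le> enat n)"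
    by (cases "return_time X S \<omega>") auto
  also have "\<dots> \<longleftrightarrow> (\<forall>t\<ge>1. X t \<omega> \<notin> S)"
    unfolding return_time_le_iff by fastforce
  finally show ?thesis .
qed

text \<open>The integrand of \<open>payoff\<close> at the return time, named so that bounds and
  limits can be taken path by path.\<close>

definition reward :: "(nat \<Rightarrow> 'w \<Rightarrow> 'a) \<Rightarrow> (nat \<Rightarrow> real) \<Rightarrow> ('a \<Rightarrow> real) \<Rightarrow> 'a set \<Rightarrow> 'w \<Rightarrow> real" where
  "reward X \<delta> f S \<omega> =
     (case return_time X S \<omega> of enat t \<Rightarrow> \<delta> t * f (X t \<omega>) | \<infinity> \<Rightarrow> 0)"

text \<open>The event that the return time exceeds \<open>k\<close>. Time \<open>0\<close> does not
  count, so for \<open>k = 0\<close> there is no restriction.\<close>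

definition avoids :: "(nat \<Rightarrow> 'w \<Rightarrow> 'a) \<Rightarrow> 'a set \<Rightarrow> nat \<Rightarrow> 'w set" where
  "avoids X S k = {\<omega>. \<forall>s\<in>{1..k}. X s \<omega> \<notin> S}"

text \<open>At most one term is nonzero, the one where \<open>Suc t\<close> is the return time.
  Written as a series, the reward can be integrated term by term into first-hit values.\<close>

lemma ennreal_reward:
  assumes "\<And>k. 0 \<le> \<delta> k" and "\<And>x. 0 \<le> f x"
  shows "ennreal (reward X \<delta> f S \<omega>) =
    (\<Sum>t. indicator (avoids X S t) \<omega> *
      (indicator S (X (Suc t) \<omega>) * (ennreal (\<delta> (Suc t)) * ennreal (f (X (Suc t) \<omega>)))))"
proof -
  have ind: "indicator (avoids X S t) \<omega> * indicator S (X (Suc t) \<omega>) =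
      (if return_time X S \<omega> = enat (Suc t) then 1 else (0::ennreal))" for t
    by (auto simp: return_time_eq_enat_iff avoids_def indicator_def less_Suc_eq_le)
  have "(\<Sum>t. indicator (avoids X S t) \<omega> *
      (indicator S (X (Suc t) \<omega>) * (ennreal (\<delta> (Suc t)) * ennreal (f (X (Suc t) \<omega>))))) =
     (\<Sum>t. if return_time X S \<omega> = enat (Suc t)
        then ennreal (\<delta> (Suc t)) * ennreal (f (X (Suc t) \<omega>)) else 0)"
    unfolding mult.assoc[symmetric] ind by (intro suminf_cong) auto
  also have "\<dots> = ennreal (reward X \<delta> f S \<omega>)"
  proof (cases "return_time X S \<omega>")
    case (enat t)
    then obtain u where "t = Suc u"
      by (cases t) (auto simp: return_time_eq_enat_iff)
    with enat show ?thesis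
      using assms
      by (subst suminf_finite[of "{u}"]) (auto simp: reward_def ennreal_mult)
  qed (simp add: reward_def)
  finally show ?thesis ..
qed

lemma reward_nonneg: "(\<And>k. 0 \<le> \<delta> k) \<Longrightarrow> (\<And>x. 0 \<le> f x) \<Longrightarrow> 0 \<le> reward X \<delta> f S \<omega>"
  by (auto simp: reward_def split: enat.split)

text \<open>The return time is at least \<open>k\<close>, possibly infinite with reward zero, so the
  discount factor is at most \<open>\<delta> k\<close>.\<close>

lemma reward_le:
  assumes \<delta>: "\<And>k. \<delta> k \<in> {0..1}" "antimono \<delta>" and f: "\<And>x. 0 \<le> f x" "\<And>x. f x \<le> C"
    and avoid: "\<forall>s\<in>{1..<k}. X s \<omega> \<notin> S"
  shows "reward X \<delta> f S \<omega> \<le> \<delta> k * C"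
proof (cases "return_time X S \<omega>")
  case (enat t)
  then have "k \<le> t"
    using avoid by (auto simp: return_time_eq_enat_iff not_less[symmetric])
  then have "\<delta> t * f (X t \<omega>) \<le> \<delta> k * C"
    using \<delta> f by (intro mult_mono antimonoD[OF \<delta>(2)]) auto
  with enat show ?thesis by (simp add: reward_def)
next
  case infinity
  \<comment> \<open>The value of \<open>f\<close> at an arbitrary point shows that
    \<open>0 \<le> C\<close>.\<close>
  then show ?thesis
    using \<delta>(1)[of k] f[of undefined] by (auto simp: reward_def)
qed

text \<open>If the intersection is first hit at a finite time, the finitely many earlier states
  leave \<open>T n\<close> for good, so the rewards are eventually constant. If it is never hit, the
  return times to \<open>T n\<close> pass every bound and discounting kills the rewards.\<close>

lemma reward_tendsto:
  assumes \<delta>: "\<And>k. \<delta> k \<in> {0..1}" "antimono \<delta>" "\<delta> \<longlonglongrightarrow> 0"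
    and f: "\<And>x. 0 \<le> f x" "\<And>x. f x \<le> C" and T: "decseq T"
  shows "(\<lambda>n. reward X \<delta> f (T n) \<omega>) \<longlonglongrightarrow> reward X \<delta> f (\<Inter>n. T n) \<omega>"
proof -
  have leave: "\<forall>\<^sub>F n in sequentially. \<forall>s\<in>{1..<k}. X s \<omega> \<notin> T n"
    if "\<forall>s\<in>{1..<k}. X s \<omega> \<notin> (\<Inter>n. T n)" for k
  proof (subst eventually_ball_finite_distrib)
    show "\<forall>s\<in>{1..<k}. \<forall>\<^sub>F n in sequentially. X s \<omega> \<notin> T n"
    proof
      fix s assume "s \<in> {1..<k}"
      from bspec[OF that this] obtain N where "X s \<omega> \<notin> T N" by blast
      then have "\<forall>n\<ge>N. X s \<omega> \<notin> T n"
        using decseqD[OF T] by blast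
      then show "\<forall>\<^sub>F n in sequentially. X s \<omega> \<notin> T n"
        by (auto simp: eventually_sequentially)
    qed
  qed simp
  show ?thesis
  proof (cases "return_time X (\<Inter>n. T n) \<omega>")
    case (enat t)
    then have t: "1 \<le> t" "\<And>n. X t \<omega> \<in> T n" "\<forall>s\<in>{1..<t}. X s \<omega> \<notin> (\<Inter>n. T n)"
      by (auto simp: return_time_eq_enat_iff)
    have "\<forall>\<^sub>F n in sequentially. reward X \<delta> f (T n) \<omega> = reward X \<delta> f (\<Inter>n. T n) \<omega>"
      using leave[OF t(3)]
    proof eventually_elim
      case (elim n)
      then have "return_time X (T n) \<omega> = enat t"
        using t by (simp add: return_time_eq_enat_iff)
      with enat show ?case by (simp add: reward_def)
    qed
    then show ?thesis by (rule tendsto_eventually)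
  next
    case infinity
    have "(\<lambda>n. reward X \<delta> f (T n) \<omega>) \<longlonglongrightarrow> 0"
    proof (rule order_tendstoI)
      fix a :: real assume "a < 0"
      moreover have "0 \<le> reward X \<delta> f (T n) \<omega>" for n
        using \<delta>(1) f(1) by (intro reward_nonneg) auto
      ultimately show "\<forall>\<^sub>F n in sequentially. a < reward X \<delta> f (T n) \<omega>"
        by (intro always_eventually allI) (rule less_le_trans)
    next
      fix a :: real assume "0 < a"
      \<comment> \<open>First \<open>k\<close> is chosen to make the discounted bound small, then
        \<open>n\<close> so large that \<open>T n\<close> is avoided before time
        \<open>k\<close>.\<close>
      have "(\<lambda>k. \<delta> k * C) \<longlonglongrightarrow> 0 * C" by (intro tendsto_intros \<delta>(3))
      then have "\<forall>\<^sub>F k in sequentially. \<delta> k * C < a"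
        using \<open>0 < a\<close> by (intro order_tendstoD(2)) auto
      then obtain k where k: "\<delta> k * C < a"
        by (auto simp: eventually_sequentially)
      from infinity have "\<forall>s\<in>{1..<k}. X s \<omega> \<notin> (\<Inter>n. T n)"
        by (auto simp: return_time_eq_infinity_iff)
      from leave[OF this] show "\<forall>\<^sub>F n in sequentially. reward X \<delta> f (T n) \<omega> < a"
      proof eventually_elim
        case (elim n)
        from reward_le[of \<delta> f C k X \<omega> "T n", OF \<delta>(1,2) f elim] k show ?case by simp
      qed
    qed
    with infinity show ?thesis by (simp add: reward_def)
  qed
qed

section \<open>The Markov property in integrated form, and the law of the first hit\<close>

context markov_process
begin

lemma sets_Q: "sets (Q x) = sets borel"
  by (rule kernel_sets_prob_space(1)[OF kernel])

lemma space_P: "space (P x) = space \<Omega>"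
  by (rule sets_eq_imp_space_eq[OF sets_P])

lemma measurable_X_P [measurable]: "X t \<in> P x \<rightarrow>\<^sub>M borel"
  using measurable_X[of t] sets_P by (simp cong: measurable_cong_sets)

lemma subalgebra_natural_filtration: "subalgebra (P x) (natural_filtration \<Omega> X t)"
proof -
  have "X s -` A \<inter> space \<Omega> \<in> sets \<Omega>" if "A \<in> sets borel" for s and A :: "'a set"
    using measurable_X that by (rule measurable_sets)
  then have "(\<Union>s\<in>{..t}. {X s -` A \<inter> space \<Omega> |A. A \<in> sets borel}) \<subseteq> sets \<Omega>"
    by auto
  then have "sigma_sets (space \<Omega>) (\<Union>s\<in>{..t}. {X s -` A \<inter> space \<Omega> |A. A \<in> sets borel}) \<subseteq> sets \<Omega>"
    by (rule sets.sigma_sets_subset)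
  moreover have "sets (natural_filtration \<Omega> X t) =
      sigma_sets (space \<Omega>) (\<Union>s\<in>{..t}. {X s -` A \<inter> space \<Omega> |A. A \<in> sets borel})"
    unfolding natural_filtration_def by (rule sets_measure_of) auto
  moreover have "space (natural_filtration \<Omega> X t) = space \<Omega>"
    unfolding natural_filtration_def by (rule space_measure_of) auto
  ultimately show ?thesis
    by (auto simp: subalgebra_def space_P sets_P)
qed

lemma nn_integral_Q_measurable:
  assumes "g \<in> borel_measurable borel"
  shows "(\<lambda>y. \<integral>\<^sup>+z. g z \<partial>Q y) \<in> borel_measurable borel"
proof -
  note [measurable] = assms measurable_prob_algebraD[OF kernel]
  show ?thesis by measurable
qed

text \<open>The assumption \<open>markov\<close> integrated over an event \<open>B\<close> of the
  past. The identity is first obtained for real integrals, where \<open>real_cond_exp\<close> lives;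
  both integrands are bounded by \<open>1\<close>, so it transfers to
  \<open>ennreal\<close>.\<close>

lemma markov_indicator:
  assumes A [measurable]: "A \<in> sets borel" and B: "B \<in> sets (natural_filtration \<Omega> X k)"
  shows "(\<integral>\<^sup>+\<omega>. indicator B \<omega> * indicator A (X (Suc k) \<omega>) \<partial>P x) =
    (\<integral>\<^sup>+\<omega>. indicator B \<omega> * emeasure (Q (X k \<omega>)) A \<partial>P x)"
proof -
  interpret prob_space "P x" by (rule prob_space_P)
  interpret sa: finite_measure_subalgebra "P x" "natural_filtration \<Omega> X k"
    by unfold_locales (rule subalgebra_natural_filtration)
  have [measurable]: "B \<in> sets (P x)"
    using B subalgebra_natural_filtration by (auto simp: subalgebra_def)
  have probQ: "prob_space (Q y)" for y
    by (rule kernel_sets_prob_space(2)[OF kernel])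
  note [measurable] = measurable_prob_algebraD[OF kernel]
  have int1: "integrable (P x) (\<lambda>\<omega>. indicator A (X (Suc k) \<omega>) :: real)"
    by (rule integrable_const_bound[where B=1]) auto
  have [measurable]: "(\<lambda>\<omega>. measure (Q (X k \<omega>)) A) \<in> borel_measurable (P x)"
    by measurable
  have le1: "measure (Q y) A \<le> 1" for y
    using probQ by (rule prob_space.prob_le_1)
  have "(\<integral>\<omega>. indicator B \<omega> * indicator A (X (Suc k) \<omega>) \<partial>P x) =
      (\<integral>\<omega>. indicator B \<omega> * measure (Q (X k \<omega>)) A \<partial>P x :: real)"
  proof -
    have "(\<integral>\<omega>. indicator B \<omega> * indicator A (X (Suc k) \<omega>) \<partial>P x :: real) =
      (\<integral>\<omega>. indicator B \<omega> * real_cond_exp (P x) (natural_filtration \<Omega> X k)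
         (\<lambda>\<omega>'. indicator A (X (Suc k) \<omega>')) \<omega> \<partial>P x)"
      using sa.real_cond_exp_intA[OF int1 B] by (simp add: set_lebesgue_integral_def)
    also have "\<dots> = (\<integral>\<omega>. indicator B \<omega> * measure (Q (X k \<omega>)) A \<partial>P x)"
      using markov[OF A, of x k] by (intro integral_cong_AE) auto
    finally show ?thesis .
  qed
  moreover have "ennreal (\<integral>\<omega>. indicator B \<omega> * indicator A (X (Suc k) \<omega>) \<partial>P x) =
      (\<integral>\<^sup>+\<omega>. ennreal (indicator B \<omega> * indicator A (X (Suc k) \<omega>)) \<partial>P x)"
    by (intro nn_integral_eq_integral[symmetric] integrable_const_bound[where B=1])
       (auto simp: indicator_def)
  moreover have "ennreal (\<integral>\<omega>. indicator B \<omega> * measure (Q (X k \<omega>)) A \<partial>P x) =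
      (\<integral>\<^sup>+\<omega>. ennreal (indicator B \<omega> * measure (Q (X k \<omega>)) A) \<partial>P x)"
    using le1
    by (intro nn_integral_eq_integral[symmetric] integrable_const_bound[where B=1])
       (auto simp: indicator_def)
  ultimately show ?thesis
    using probQ
    by (simp add: ennreal_mult ennreal_indicator finite_measure.emeasure_eq_measure
          prob_space.finite_measure)
qed

text \<open>Extends the identity from indicators to nonnegative Borel functions: both sides are
  linear in \<open>g\<close> and respect monotone limits.\<close>

lemma markov_nn_integral:
  assumes g: "g \<in> borel_measurable borel" and B: "B \<in> sets (natural_filtration \<Omega> X k)"
  shows "(\<integral>\<^sup>+\<omega>. indicator B \<omega> * g (X (Suc k) \<omega>) \<partial>P x) =
    (\<integral>\<^sup>+\<omega>. indicator B \<omega> * (\<integral>\<^sup>+y. g y \<partial>Q (X k \<omega>)) \<partial>P x)"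
  using g
proof (induction rule: borel_measurable_induct)
  case (cong g h)
  \<comment> \<open>The space of \<open>borel\<close> is the whole type, so agreement on it is
    equality.\<close>
  then have "g = h" by auto
  with cong show ?case by simp
next
  case (set A)
  then show ?case
    using markov_indicator[OF set B] by (simp add: sets_Q)
next
  case (mult u c)
  have [measurable]: "B \<in> sets (P x)"
    using B subalgebra_natural_filtration by (auto simp: subalgebra_def)
  note [measurable] = mult(2) nn_integral_Q_measurable[OF mult(2)]
  note [measurable_cong] = sets_Q
  have "(\<integral>\<^sup>+\<omega>. indicator B \<omega> * (c * u (X (Suc k) \<omega>)) \<partial>P x) =
      c * (\<integral>\<^sup>+\<omega>. indicator B \<omega> * u (X (Suc k) \<omega>) \<partial>P x)"
    by (simp add: nn_integral_cmult[symmetric] ac_simps)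
  also have "\<dots> = (\<integral>\<^sup>+\<omega>. indicator B \<omega> * (\<integral>\<^sup>+y. c * u y \<partial>Q (X k \<omega>)) \<partial>P x)"
    unfolding mult.IH by (simp add: nn_integral_cmult mult.left_commute)
  finally show ?case .
next
  case (add u v)
  have [measurable]: "B \<in> sets (P x)"
    using B subalgebra_natural_filtration by (auto simp: subalgebra_def)
  note [measurable] = \<open>u \<in> borel_measurable borel\<close> \<open>v \<in> borel_measurable borel\<close>
  note [measurable] = \<open>u \<in> borel_measurable borel\<close>[THEN nn_integral_Q_measurable]
    \<open>v \<in> borel_measurable borel\<close>[THEN nn_integral_Q_measurable]
  note [measurable_cong] = sets_Q
  have "(\<integral>\<^sup>+\<omega>. indicator B \<omega> * (v (X (Suc k) \<omega>) + u (X (Suc k) \<omega>)) \<partial>P x) =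
      (\<integral>\<^sup>+\<omega>. indicator B \<omega> * v (X (Suc k) \<omega>) \<partial>P x) +
      (\<integral>\<^sup>+\<omega>. indicator B \<omega> * u (X (Suc k) \<omega>) \<partial>P x)"
    unfolding distrib_left by (rule nn_integral_add) measurable
  also have "\<dots> = (\<integral>\<^sup>+\<omega>. indicator B \<omega> * (\<integral>\<^sup>+y. v y \<partial>Q (X k \<omega>)) \<partial>P x) +
      (\<integral>\<^sup>+\<omega>. indicator B \<omega> * (\<integral>\<^sup>+y. u y \<partial>Q (X k \<omega>)) \<partial>P x)"
    by (simp only: add.IH)
  also have "\<dots> = (\<integral>\<^sup>+\<omega>. indicator B \<omega> *
      ((\<integral>\<^sup>+y. v y \<partial>Q (X k \<omega>)) + (\<integral>\<^sup>+y. u y \<partial>Q (X k \<omega>))) \<partial>P x)"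
    unfolding distrib_left by (rule nn_integral_add[symmetric]) measurable
  also have "\<dots> = (\<integral>\<^sup>+\<omega>. indicator B \<omega> * (\<integral>\<^sup>+y. v y + u y \<partial>Q (X k \<omega>)) \<partial>P x)"
    by (simp add: nn_integral_add)
  finally show ?case .
next
  case (seq U)
  have [measurable]: "B \<in> sets (P x)"
    using B subalgebra_natural_filtration by (auto simp: subalgebra_def)
  note [measurable] = seq(1) nn_integral_Q_measurable[OF seq(1)]
  note [measurable_cong] = sets_Q
  have "(\<integral>\<^sup>+\<omega>. indicator B \<omega> * (SUP i. U i) (X (Suc k) \<omega>) \<partial>P x) =
      (SUP i. \<integral>\<^sup>+\<omega>. indicator B \<omega> * U i (X (Suc k) \<omega>) \<partial>P x)"
    using seq(3)
    by (subst nn_integral_monotone_convergence_SUP[symmetric])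
       (auto simp: incseq_def le_fun_def SUP_mult_left_ennreal image_comp intro!: mult_left_mono)
  also have "\<dots> = (SUP i. \<integral>\<^sup>+\<omega>. indicator B \<omega> * (\<integral>\<^sup>+y. U i y \<partial>Q (X k \<omega>)) \<partial>P x)"
    using seq by simp
  also have "\<dots> = (\<integral>\<^sup>+\<omega>. (SUP i. indicator B \<omega> * (\<integral>\<^sup>+y. U i y \<partial>Q (X k \<omega>))) \<partial>P x)"
    using seq(3)
    by (subst nn_integral_monotone_convergence_SUP[symmetric])
       (auto simp: incseq_def le_fun_def intro!: mult_left_mono nn_integral_mono)
  also have "\<dots> = (\<integral>\<^sup>+\<omega>. indicator B \<omega> * (\<integral>\<^sup>+y. (SUP i. U i) y \<partial>Q (X k \<omega>)) \<partial>P x)"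
    using seq(3)
    by (simp add: SUP_mult_left_ennreal[symmetric] nn_integral_monotone_convergence_SUP image_comp)
  finally show ?case .
qed

lemma avoids_natural_filtration:
  assumes "S \<in> sets borel"
  shows "avoids X S k \<inter> space \<Omega> \<in> sets (natural_filtration \<Omega> X k)"
proof -
  have "avoids X S k \<inter> space \<Omega> =
      space (natural_filtration \<Omega> X k) - {\<omega> \<in> space \<Omega>. return_time X S \<omega> \<le> enat k}"
    using subalgebra_natural_filtration
    by (auto simp: subalgebra_def space_P avoids_def return_time_le_iff)
  with return_time_stopping[OF assms] show ?thesis by auto
qed

text \<open>\<open>avoids\<close> is not cut down to the sample space, so its intersection with
  \<open>space \<Omega>\<close> is treated first; on \<open>space (P x)\<close> the two indicators
  agree.\<close>

lemma avoids_measurable: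
  assumes "S \<in> sets borel"
  shows "(\<lambda>\<omega>. indicator (avoids X S k) \<omega> :: ennreal) \<in> borel_measurable (P x)"
proof -
  have [measurable]: "avoids X S k \<inter> space \<Omega> \<in> sets (P x)"
    using avoids_natural_filtration[OF assms, of k] subalgebra_natural_filtration[of x k]
    by (auto simp: subalgebra_def)
  have "(\<lambda>\<omega>. indicator (avoids X S k \<inter> space \<Omega>) \<omega> :: ennreal) \<in> borel_measurable (P x)"
    by measurable
  then show ?thesis
    by (rule measurable_cong[THEN iffD1, rotated]) (auto simp: space_P indicator_def)
qed

lemma markov_avoids:
  assumes "S \<in> sets borel" and "g \<in> borel_measurable borel"
  shows "(\<integral>\<^sup>+\<omega>. indicator (avoids X S k) \<omega> * g (X (Suc k) \<omega>) \<partial>P x) =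
    (\<integral>\<^sup>+\<omega>. indicator (avoids X S k) \<omega> * (\<integral>\<^sup>+y. g y \<partial>Q (X k \<omega>)) \<partial>P x)"
proof -
  have "(\<integral>\<^sup>+\<omega>. indicator (avoids X S k) \<omega> * h \<omega> \<partial>P x) =
      (\<integral>\<^sup>+\<omega>. indicator (avoids X S k \<inter> space \<Omega>) \<omega> * h \<omega> \<partial>P x)" for h
    by (intro nn_integral_cong) (auto simp: space_P indicator_def)
  then show ?thesis
    using markov_nn_integral[OF assms(2) avoids_natural_filtration[OF assms(1)]] by simp
qed

text \<open>Each induction step applies the Markov property at time \<open>k\<close> and trades one
  unit of \<open>n\<close> for one of \<open>k\<close>. The case of interest is
  \<open>k = 0\<close>; general \<open>k\<close> makes the induction go through.\<close>

lemma nn_integral_first_hit_value: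
  assumes S [measurable]: "S \<in> sets borel" and g [measurable]: "g \<in> borel_measurable borel"
  shows "(\<integral>\<^sup>+\<omega>. indicator (avoids X S k) \<omega> * first_hit_value Q S g n (X k \<omega>) \<partial>P x) =
    (\<integral>\<^sup>+\<omega>. indicator (avoids X S (k + n)) \<omega> *
       (indicator S (X (Suc (k + n)) \<omega>) * g (X (Suc (k + n)) \<omega>)) \<partial>P x)"
proof (induction n arbitrary: k)
  case 0
  show ?case
    by (simp add: markov_avoids[OF S, of "\<lambda>y. indicator S y * g y", symmetric])
next
  case (Suc n)
  note [measurable] = first_hit_value_measurable[OF kernel S g]
  have "(\<integral>\<^sup>+\<omega>. indicator (avoids X S k) \<omega> * first_hit_value Q S g (Suc n) (X k \<omega>) \<partial>P x) =
      (\<integral>\<^sup>+\<omega>. indicator (avoids X S k) \<omega> *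
        (indicator (- S) (X (Suc k) \<omega>) * first_hit_value Q S g n (X (Suc k) \<omega>)) \<partial>P x)"
    by (simp add: markov_avoids[OF S, of "\<lambda>y. indicator (- S) y * first_hit_value Q S g n y"])
  also have "\<dots> = (\<integral>\<^sup>+\<omega>. indicator (avoids X S (Suc k)) \<omega> *
      first_hit_value Q S g n (X (Suc k) \<omega>) \<partial>P x)"
    by (intro nn_integral_cong) (auto simp: avoids_def indicator_def atLeastAtMostSuc_conv)
  finally show ?case
    using Suc[of "Suc k"] by simp
qed

text \<open>At \<open>k = 0\<close> nothing has to be avoided and \<open>X 0\<close> is almost
  surely \<open>x\<close>.\<close>

lemma first_hit_value_eq:
  assumes S: "S \<in> sets borel" and g: "g \<in> borel_measurable borel"
  shows "(\<integral>\<^sup>+\<omega>. indicator (avoids X S n) \<omega> *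
      (indicator S (X (Suc n) \<omega>) * g (X (Suc n) \<omega>)) \<partial>P x) = first_hit_value Q S g n x"
proof -
  interpret prob_space "P x" by (rule prob_space_P)
  have "(\<integral>\<^sup>+\<omega>. indicator (avoids X S 0) \<omega> * first_hit_value Q S g n (X 0 \<omega>) \<partial>P x) =
      (\<integral>\<^sup>+\<omega>. first_hit_value Q S g n x \<partial>P x)"
    using start[of x] by (intro nn_integral_cong_AE) (auto simp: avoids_def)
  then show ?thesis
    using nn_integral_first_hit_value[OF S g, of x 0 n] by (simp add: emeasure_space_1)
qed

section \<open>Payoffs, the operator \<open>Theta\<close> and its iterates\<close>

context
  fixes \<delta> :: "nat \<Rightarrow> real" and f :: "'a \<Rightarrow> real" and C :: real
  assumes \<delta>: "\<And>k. \<delta> k \<in> {0..1}" "antimono \<delta>" "\<delta> \<longlonglongrightarrow> 0" "\<And>i j. \<delta> i * \<delta> j \<le> \<delta> (i + j)"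
    and f: "f \<in> borel_measurable borel" "\<And>x. 0 \<le> f x" "\<And>x. f x \<le> C"
begin

text \<open>The payoff of waiting for the next visit to \<open>S\<close>, expressed through
  \<open>Q\<close>; \<open>ennreal_payoff\<close> justifies this reading.\<close>

abbreviation "value_on S \<equiv> shifted_value Q S (\<lambda>y. ennreal (f y)) (\<lambda>k. ennreal (\<delta> k)) 0"

lemma payoff_eq: "payoff P X \<delta> f x (return_time X S) = (\<integral>\<omega>. reward X \<delta> f S \<omega> \<partial>P x)"
  by (simp add: payoff_def reward_def)

lemma reward_measurable:
  assumes S [measurable]: "S \<in> sets borel"
  shows "reward X \<delta> f S \<in> borel_measurable (P x)"
proof -
  note [measurable] = f(1) avoids_measurable[OF S]
  \<comment> \<open>Rewards are nonnegative, so the round trip through \<open>ennreal\<close>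
    changes nothing and gives access to the series.\<close>
  have "reward X \<delta> f S = (\<lambda>\<omega>. enn2real (ennreal (reward X \<delta> f S \<omega>)))"
    using \<delta>(1) f(2) by (intro ext) (simp add: reward_nonneg)
  also have "\<dots> \<in> borel_measurable (P x)"
    using \<delta>(1) f(2) by (subst ennreal_reward) (auto)
  finally show ?thesis .
qed

lemma reward_bounds: "0 \<le> reward X \<delta> f S \<omega>" "reward X \<delta> f S \<omega> \<le> C"
proof -
  show "0 \<le> reward X \<delta> f S \<omega>"
    using \<delta>(1) f(2) by (intro reward_nonneg) auto
  have "reward X \<delta> f S \<omega> \<le> \<delta> 0 * C"
    using \<delta> f by (intro reward_le) auto
  also have "\<dots> \<le> 1 * C"
    using \<delta>(1)[of 0] f(2,3)[of undefined] by (intro mult_right_mono) auto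
  finally show "reward X \<delta> f S \<omega> \<le> C" by simp
qed

text \<open>Integrating the series of \<open>ennreal_reward\<close> term by term leaves discount
  factors times first-hit values.\<close>

lemma ennreal_payoff:
  assumes S [measurable]: "S \<in> sets borel"
  shows "ennreal (payoff P X \<delta> f x (return_time X S)) = value_on S x"
proof -
  interpret prob_space "P x" by (rule prob_space_P)
  note [measurable] = f(1) avoids_measurable[OF S] reward_measurable[OF S]
  have "ennreal (payoff P X \<delta> f x (return_time X S)) = (\<integral>\<^sup>+\<omega>. ennreal (reward X \<delta> f S \<omega>) \<partial>P x)"
    unfolding payoff_eq using reward_bounds
    by (intro nn_integral_eq_integral[symmetric] integrable_const_bound[where B=C]) auto
  also have "\<dots> = (\<integral>\<^sup>+\<omega>. (\<Sum>t. indicator (avoids X S t) \<omega> * (indicator S (X (Suc t) \<omega>) *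
      (ennreal (\<delta> (Suc t)) * ennreal (f (X (Suc t) \<omega>))))) \<partial>P x)"
    using \<delta>(1) f(2) by (subst ennreal_reward) auto
  also have "\<dots> = (\<Sum>t. \<integral>\<^sup>+\<omega>. indicator (avoids X S t) \<omega> * (indicator S (X (Suc t) \<omega>) *
      (ennreal (\<delta> (Suc t)) * ennreal (f (X (Suc t) \<omega>)))) \<partial>P x)"
    by (rule nn_integral_suminf) measurable
  also have "\<dots> = (\<Sum>t. ennreal (\<delta> (Suc t)) * (\<integral>\<^sup>+\<omega>. indicator (avoids X S t) \<omega> *
      (indicator S (X (Suc t) \<omega>) * ennreal (f (X (Suc t) \<omega>))) \<partial>P x))"
    by (subst nn_integral_cmult[symmetric]) (auto simp: ac_simps)
  also have "\<dots> = value_on S x"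
    using first_hit_value_eq[OF S, of "\<lambda>y. ennreal (f y)"]
    by (simp add: shifted_value_def)
  finally show ?thesis .
qed

lemma payoff_nonneg: "0 \<le> payoff P X \<delta> f x (return_time X S)"
  unfolding payoff_eq using reward_bounds by (intro Bochner_Integration.integral_nonneg) auto

lemma mem_Theta_iff:
  assumes "S \<in> sets borel"
  shows "x \<in> Theta P X \<delta> f S \<longleftrightarrow> value_on S x \<le> ennreal (f x)"
  using ennreal_payoff[OF assms, of x] f(2)[of x]
  by (simp add: Theta_def flip: ennreal_payoff[OF assms])

text \<open>Once the payoff is written as \<open>value_on S\<close>, the set compares two Borel
  functions of the starting point.\<close>

lemma Theta_measurable:
  assumes "S \<in> sets borel"
  shows "Theta P X \<delta> f S \<in> sets borel"
proof -
  note [measurable] = f(1)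
  have [measurable]: "value_on S \<in> borel_measurable borel"
    by (intro shifted_value_measurable kernel assms) measurable
  have "Theta P X \<delta> f S = {x. value_on S x \<le> ennreal (f x)}"
    using mem_Theta_iff[OF assms] by auto
  then show ?thesis by simp
qed

text \<open>At points of \<open>S\<close> outside \<open>Theta P X \<delta> f S\<close>,
  \<open>f\<close> is below the value of waiting for \<open>S\<close>; this is the premise
  \<open>wait\<close> of \<open>shifted_value_mono\<close>.\<close>

lemma payoff_le_payoff_Theta:
  assumes S: "S \<in> sets borel" and sub: "Theta P X \<delta> f S \<subseteq> S"
  shows "payoff P X \<delta> f x (return_time X S) \<le> payoff P X \<delta> f x (return_time X (Theta P X \<delta> f S))"
proof -
  note [measurable] = f(1)
  have "value_on S x \<le> value_on (Theta P X \<delta> f S) x"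
  proof (rule shifted_value_mono[OF kernel S Theta_measurable[OF S], where C="ennreal C"])
    show "(\<lambda>k. ennreal (\<delta> k)) \<longlonglongrightarrow> 0"
      using tendsto_ennrealI[OF \<delta>(3)] by simp
    show "antimono (\<lambda>k. ennreal (\<delta> k))"
      using \<delta>(2) by (auto simp: antimono_def intro: ennreal_leI)
    show "ennreal (\<delta> i) * ennreal (\<delta> j) \<le> ennreal (\<delta> (i + j))" for i j
      using \<delta>(1,4) by (simp add: ennreal_mult[symmetric] ennreal_leI)
    show "ennreal (f y) \<le> value_on S y" if "y \<in> S - Theta P X \<delta> f S" for y
      using that by (auto simp: mem_Theta_iff[OF S])
  qed (use f sub in \<open>auto intro: ennreal_leI\<close>)
  then show ?thesis
    using payoff_nonneg
    by (simp add: ennreal_payoff[OF S, symmetric] ennreal_payoff[OF Theta_measurable[OF S], symmetric])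
qed

text \<open>Where \<open>f\<close> dominates the payoff for \<open>Theta P X \<delta> f S\<close>,
  it dominates the smaller payoff for \<open>S\<close>. So the inclusion assumed of \<open>S\<close>
  is inherited by its image, and the iteration can continue.\<close>

lemma Theta_decreasing:
  assumes "S \<in> sets borel" and "Theta P X \<delta> f S \<subseteq> S"
  shows "Theta P X \<delta> f (Theta P X \<delta> f S) \<subseteq> Theta P X \<delta> f S"
  using payoff_le_payoff_Theta[OF assms] by (auto simp: Theta_def intro: order_trans)

lemma payoff_tendsto:
  assumes T: "\<And>n. T n \<in> sets borel" "decseq T"
  shows "(\<lambda>n. payoff P X \<delta> f x (return_time X (T n)))
    \<longlonglongrightarrow> payoff P X \<delta> f x (return_time X (\<Inter>n. T n))"
  unfolding payoff_eq
proof (rule integral_dominated_convergence[where w="\<lambda>_. C"])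
  interpret prob_space "P x" by (rule prob_space_P)
  show "integrable (P x) (\<lambda>_. C)" by simp
  show "AE \<omega> in P x. (\<lambda>n. reward X \<delta> f (T n) \<omega>) \<longlonglongrightarrow> reward X \<delta> f (\<Inter>n. T n) \<omega>"
    using reward_tendsto[of \<delta> f C T X, OF \<delta>(1-3) f(2,3) T(2)] by auto
qed (use T reward_bounds in \<open>auto intro!: reward_measurable\<close>)

theorem iterated_Theta_equilibrium:
  assumes S: "S \<in> sets borel" and sub: "Theta P X \<delta> f S \<subseteq> S"
  defines "T \<equiv> \<Inter>n\<in>{1..}. (Theta P X \<delta> f ^^ n) S"
  shows "T \<noteq> {}" and "equilibrium P X \<delta> f T"
proof -
  define U where "U n = (Theta P X \<delta> f ^^ n) S" for n
  have U_Suc: "U (Suc n) = Theta P X \<delta> f (U n)" for n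
    by (simp add: U_def)
  have U: "U n \<in> sets borel \<and> Theta P X \<delta> f (U n) \<subseteq> U n" for n
  proof (induction n)
    case 0
    show ?case using S sub by (simp add: U_def)
  next
    case (Suc n)
    then show ?case by (auto simp: U_Suc intro!: Theta_measurable dest: Theta_decreasing)
  qed
  have dec: "decseq U"
    using U by (intro decseq_SucI) (simp add: U_Suc)
  \<comment> \<open>\<open>U\<close> starts at \<open>n = 0\<close> but \<open>T\<close> at
    \<open>n = 1\<close>; as \<open>U\<close> decreases, including \<open>U 0 = S\<close> leaves the
    intersection unchanged.\<close>
  have T: "T = (\<Inter>n. U n)"
  proof (rule antisym)
    show "T \<subseteq> (\<Inter>n. U n)"
    proof (rule INT_greatest)
      fix n
      have "T \<subseteq> U (Suc n)" by (auto simp: T_def U_def simp del: funpow.simps)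
      also have "\<dots> \<subseteq> U n" using U by (simp add: U_Suc)
      finally show "T \<subseteq> U n" .
    qed
  qed (auto simp: T_def U_def)
  have T_borel: "T \<in> sets borel"
    unfolding T using U by (intro sets.countable_INT) auto
  have lim: "(\<lambda>n. payoff P X \<delta> f x (return_time X (U n))) \<longlonglongrightarrow> payoff P X \<delta> f x (return_time X T)" for x
    unfolding T using U dec by (intro payoff_tendsto) auto
  have inc: "incseq (\<lambda>n. payoff P X \<delta> f x (return_time X (U n)))" for x
    using U payoff_le_payoff_Theta by (intro incseq_SucI) (simp add: U_Suc)
  \<comment> \<open>The payoffs for \<open>U n\<close> increase to the payoff for \<open>T\<close>,
    so \<open>f x\<close> dominates the limit exactly if it dominates each of them.\<close>
  have "x \<in> Theta P X \<delta> f T \<longleftrightarrow> (\<forall>n. x \<in> U (Suc n))" for x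
    using incseq_le[OF inc lim, of x] LIMSEQ_le_const2[OF lim, of x "f x"]
    by (auto simp: U_Suc Theta_def intro: order_trans)
  also have "(\<forall>n. x \<in> U (Suc n)) \<longleftrightarrow> x \<in> T" for x
    using U unfolding T by (metis (no_types, lifting) INT_iff U_Suc UNIV_I subsetD)
  finally have fixed: "Theta P X \<delta> f T = T" by auto
  then show "equilibrium P X \<delta> f T"
    using T_borel by (simp add: equilibrium_def)
  \<comment> \<open>The empty set is never reached, so its payoff is \<open>0\<close>, which
    \<open>f\<close> dominates everywhere. An empty \<open>T\<close> would thus be mapped to the
    whole type, against \<open>fixed\<close>.\<close>
  show "T \<noteq> {}"
  proof
    assume "T = {}"
    moreover have "return_time X {} = (\<lambda>_. \<infinity>)"
      by (auto simp: return_time_eq_infinity_iff)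
    ultimately have "Theta P X \<delta> f T = UNIV"
      using f(2) by (auto simp: Theta_def payoff_def)
    with fixed \<open>T = {}\<close> show False by auto
  qed
qed

end

end

theorem theorem3p1:
  fixes \<Omega> :: "'w measure"
    and Q :: "'a::polish_space \<Rightarrow> 'a measure"
    and P :: "'a \<Rightarrow> 'w measure"
    and X :: "nat \<Rightarrow> 'w \<Rightarrow> 'a"
    and f :: "'a \<Rightarrow> real"
    and \<delta> :: "nat \<Rightarrow> real"
    and S :: "'a set"
  assumes "markov_process \<Omega> Q P X"
    and "f \<in> borel_measurable borel" and "\<And>x. 0 \<le> f x" and "bounded (range f)"
    and "\<And>k. \<delta> k \<in> {0..1}" and "strict_antimono_on UNIV \<delta>" and "\<delta> 0 = 1"
    and "\<delta> \<longlonglongrightarrow> 0"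
    and "\<And>i j. \<delta> i * \<delta> j \<le> \<delta> (i + j)"
    and "S \<in> sets borel" and "S \<noteq> {}"
    and "Theta P X \<delta> f S \<subseteq> S"
  shows "(\<Inter>n\<in>{1..}. (Theta P X \<delta> f ^^ n) S) \<noteq> {} \<and>
         equilibrium P X \<delta> f (\<Inter>n\<in>{1..}. (Theta P X \<delta> f ^^ n) S)"
proof -
  interpret markov_process \<Omega> Q P X by fact
  obtain C where C: "\<And>x. f x \<le> C"
    using assms(4) by (auto simp: bounded_iff abs_le_iff)
  have "antimono \<delta>"
    using assms(6) by (auto simp: monotone_on_def antimono_def le_less)
  from iterated_Theta_equilibrium[OF assms(5) this assms(8,9,2,3) C assms(10,12)]
  show ?thesis by simp
qed

end
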